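(* Let $R$ be a Noetherian ring and let $I$ be an ideal of $R$ minimally presented by a matrix $\varphi$. Then $\operatorname{Ann}(H_1)\subseteq I:I_1(\varphi)$. If, in addition, $I$ is syzygetic, then $\operatorname{Ann}(H_1)=I:I_1(\varphi)$.
   Context: $H_1=H_1(I)$ denotes the first homology module of the Koszul complex built on a minimal generating set $a_1,\dots,a_n$ of $I$. The matrix $\varphi$ minimally presents $I$ means that $R^m\xrightarrow{\varphi}R^n\to I\to 0$ is a (minimal) presentation, where $R^n\to I$ sends the standard basis to $a_1,\dots,a_n$; so the columns of $\varphi$ generate the module of syzygies of $a_1,\dots,a_n$. $I_1(\varphi)$ is the ideal of $R$ generated by the entries of $\varphi$. $\delta(I)$ denotes the kernel of the natural surjection $\operatorname{Sym}_2(I)\to I^2$ from the second symmetric power of $I$, and $I$ is called syzygetic if $\delta(I)=0$. *)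

theory Defs
  imports "HOL-Algebra.Ring_Divisibility" "HOL-Algebra.Ideal_Product" "HOL-Algebra.Module"
begin

subsection \<open>Modules over a commutative ring\<close>

text \<open>The record type of modules extends that of rings. The fields \<open>mult\<close> and \<open>one\<close>
  play no role in a module and are left undefined below.\<close>

definition submodule_generated ::
    "('a, 'r) ring_scheme \<Rightarrow> ('a, 'b, 'm) module_scheme \<Rightarrow> 'b set \<Rightarrow> 'b set"
  where "submodule_generated R M A = \<Inter>{N. submodule N R M \<and> A \<subseteq> N}"

definition quotient_module ::
    "('a, 'r) ring_scheme \<Rightarrow> ('a, 'b, 'm) module_scheme \<Rightarrow> 'b set \<Rightarrow> ('a, 'b set) module"
  where "quotient_module R M N =
    \<lparr> carrier = a_rcosets\<^bsub>M\<^esub> N, monoid.mult = undefined, one = undefined,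
      zero = N, add = set_add M,
      smult = (\<lambda>r C. \<Union>x\<in>C. N +>\<^bsub>M\<^esub> (r \<odot>\<^bsub>M\<^esub> x)) \<rparr>"

definition annihilator :: "('a, 'r) ring_scheme \<Rightarrow> ('a, 'b, 'm) module_scheme \<Rightarrow> 'a set"
  where "annihilator R M = {r \<in> carrier R. \<forall>x\<in>carrier M. r \<odot>\<^bsub>M\<^esub> x = \<zero>\<^bsub>M\<^esub>}"

text \<open>The free module with basis indexed by \<open>S\<close>: finitely supported functions
  \<open>S \<Rightarrow> carrier R\<close>, extensional outside \<open>S\<close>. In particular \<open>R\<close> to the power \<open>n\<close> is
  \<open>free_module R {..<n}\<close>.\<close>

definition free_module :: "('a, 'r) ring_scheme \<Rightarrow> 'i set \<Rightarrow> ('a, 'i \<Rightarrow> 'a) module"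
  where "free_module R S =
    \<lparr> carrier = {f \<in> S \<rightarrow>\<^sub>E carrier R. finite {s \<in> S. f s \<noteq> \<zero>\<^bsub>R\<^esub>}},
      monoid.mult = undefined, one = undefined,
      zero = (\<lambda>s\<in>S. \<zero>\<^bsub>R\<^esub>),
      add = (\<lambda>f g. \<lambda>s\<in>S. f s \<oplus>\<^bsub>R\<^esub> g s),
      smult = (\<lambda>r f. \<lambda>s\<in>S. r \<otimes>\<^bsub>R\<^esub> f s) \<rparr>"

definition basis_vec :: "('a, 'r) ring_scheme \<Rightarrow> 'i set \<Rightarrow> 'i \<Rightarrow> 'i \<Rightarrow> 'a"
  where "basis_vec R S i = (\<lambda>s\<in>S. if s = i then \<one>\<^bsub>R\<^esub> else \<zero>\<^bsub>R\<^esub>)"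

text \<open>An ideal of \<open>R\<close>, regarded as an \<open>R\<close>-module.\<close>

definition ideal_module :: "('a, 'r) ring_scheme \<Rightarrow> 'a set \<Rightarrow> ('a, 'a) module"
  where "ideal_module R I =
    \<lparr> carrier = I, monoid.mult = undefined, one = undefined,
      zero = \<zero>\<^bsub>R\<^esub>, add = (\<oplus>\<^bsub>R\<^esub>), smult = (\<otimes>\<^bsub>R\<^esub>) \<rparr>"

definition ideal_colon :: "('a, 'r) ring_scheme \<Rightarrow> 'a set \<Rightarrow> 'a set \<Rightarrow> 'a set"
  where "ideal_colon R I J = {r \<in> carrier R. \<forall>x\<in>J. r \<otimes>\<^bsub>R\<^esub> x \<in> I}"


subsection \<open>Koszul homology\<close>

text \<open>The term of degree \<open>p\<close> is the \<open>p\<close>-th exterior power of \<open>R\<close> to the power \<open>n\<close>: it is free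
  on the basis elements \<open>e T\<close>, where \<open>T = {t_1 < \<dots> < t_p}\<close> stands for the wedge product of
  \<open>e_(t_1), \<dots>, e_(t_p)\<close>.\<close>

definition koszul_module ::
    "('a, 'r) ring_scheme \<Rightarrow> nat \<Rightarrow> nat \<Rightarrow> ('a, nat set \<Rightarrow> 'a) module"
  where "koszul_module R n p = free_module R {T. T \<subseteq> {..<n} \<and> card T = p}"

text \<open>The differential from degree \<open>p + 1\<close> to degree \<open>p\<close>. It sends \<open>e T\<close> to the sum over
  \<open>i \<in> T\<close> of \<open>(-1)^k * a i * e (T - {i})\<close>, where \<open>k\<close> is the number of \<open>t \<in> T\<close> with \<open>t < i\<close>;
  below this is expressed in coordinates.\<close>

definition koszul_diff ::
    "('a, 'r) ring_scheme \<Rightarrow> nat \<Rightarrow> (nat \<Rightarrow> 'a) \<Rightarrow> nat \<Rightarrow> (nat set \<Rightarrow> 'a) \<Rightarrow> nat set \<Rightarrow> 'a"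
  where "koszul_diff R n a p f =
    (\<lambda>T\<in>{T. T \<subseteq> {..<n} \<and> card T = p}.
      \<Oplus>\<^bsub>R\<^esub>i\<in>{..<n} - T.
        ((\<ominus>\<^bsub>R\<^esub> \<one>\<^bsub>R\<^esub>) [^]\<^bsub>R\<^esub> card {t \<in> T. t < i}) \<otimes>\<^bsub>R\<^esub> (a i \<otimes>\<^bsub>R\<^esub> f (insert i T)))"

definition koszul_cycles ::
    "('a, 'r) ring_scheme \<Rightarrow> nat \<Rightarrow> (nat \<Rightarrow> 'a) \<Rightarrow> nat \<Rightarrow> (nat set \<Rightarrow> 'a) set"
  where "koszul_cycles R n a p =
    (case p of
       0 \<Rightarrow> carrier (koszul_module R n 0)
     | Suc q \<Rightarrow> a_kernel (koszul_module R n p) (koszul_module R n q) (koszul_diff R n a q))"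

definition koszul_boundaries ::
    "('a, 'r) ring_scheme \<Rightarrow> nat \<Rightarrow> (nat \<Rightarrow> 'a) \<Rightarrow> nat \<Rightarrow> (nat set \<Rightarrow> 'a) set"
  where "koszul_boundaries R n a p =
    koszul_diff R n a p ` carrier (koszul_module R n (Suc p))"

definition koszul_homology ::
    "('a, 'r) ring_scheme \<Rightarrow> nat \<Rightarrow> (nat \<Rightarrow> 'a) \<Rightarrow> nat \<Rightarrow> ('a, (nat set \<Rightarrow> 'a) set) module"
  where "koszul_homology R n a p =
    quotient_module R ((koszul_module R n p)\<lparr>carrier := koszul_cycles R n a p\<rparr>)
      (koszul_boundaries R n a p)"


subsection \<open>Minimal presentations\<close>

definition lin_comb :: "('a, 'r) ring_scheme \<Rightarrow> nat \<Rightarrow> (nat \<Rightarrow> 'a) \<Rightarrow> (nat \<Rightarrow> 'a) \<Rightarrow> 'a"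
  where "lin_comb R n a x = (\<Oplus>\<^bsub>R\<^esub>i\<in>{..<n}. x i \<otimes>\<^bsub>R\<^esub> a i)"

text \<open>An \<open>n\<close> by \<open>m\<close> matrix is given by its entries \<open>\<phi> i j\<close> with \<open>i < n\<close> and \<open>j < m\<close>.\<close>

definition matrix_map ::
    "('a, 'r) ring_scheme \<Rightarrow> nat \<Rightarrow> nat \<Rightarrow> (nat \<Rightarrow> nat \<Rightarrow> 'a) \<Rightarrow> (nat \<Rightarrow> 'a) \<Rightarrow> nat \<Rightarrow> 'a"
  where "matrix_map R n m \<phi> x = (\<lambda>i\<in>{..<n}. \<Oplus>\<^bsub>R\<^esub>j\<in>{..<m}. \<phi> i j \<otimes>\<^bsub>R\<^esub> x j)"

definition syzygies ::
    "('a, 'r) ring_scheme \<Rightarrow> 'a set \<Rightarrow> nat \<Rightarrow> (nat \<Rightarrow> 'a) \<Rightarrow> (nat \<Rightarrow> 'a) set"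
  where "syzygies R I n a =
    a_kernel (free_module R {..<n}) (ideal_module R I) (lin_comb R n a)"

text \<open>Exactness of \<open>R^m \<rightarrow> R^n \<rightarrow> I \<rightarrow> 0\<close>.\<close>

definition presentation ::
    "('a, 'r) ring_scheme \<Rightarrow> 'a set \<Rightarrow> nat \<Rightarrow> nat \<Rightarrow> (nat \<Rightarrow> 'a) \<Rightarrow> (nat \<Rightarrow> nat \<Rightarrow> 'a) \<Rightarrow> bool"
  where "presentation R I n m a \<phi> \<longleftrightarrow>
    (\<forall>i<n. a i \<in> carrier R) \<and>
    (\<forall>i<n. \<forall>j<m. \<phi> i j \<in> carrier R) \<and>
    lin_comb R n a ` carrier (free_module R {..<n}) = I \<and>
    matrix_map R n m \<phi> ` carrier (free_module R {..<m}) = syzygies R I n a"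

text \<open>Since \<open>R\<close> need not be local, minimality is understood as irredundancy: no \<open>a i\<close> can be
  omitted from the generators of \<open>I\<close>, and no column of \<open>\<phi>\<close> from the generators of the module
  of syzygies. Over a local ring this agrees with having the least number of generators.\<close>

definition minimal_presentation ::
    "('a, 'r) ring_scheme \<Rightarrow> 'a set \<Rightarrow> nat \<Rightarrow> nat \<Rightarrow> (nat \<Rightarrow> 'a) \<Rightarrow> (nat \<Rightarrow> nat \<Rightarrow> 'a) \<Rightarrow> bool"
  where "minimal_presentation R I n m a \<phi> \<longleftrightarrow>
    presentation R I n m a \<phi> \<and>
    (\<forall>k<n. genideal R (a ` ({..<n} - {k})) \<noteq> I) \<and>
    (\<forall>k<m. submodule_generated R (free_module R {..<n})
             ((\<lambda>j. \<lambda>i\<in>{..<n}. \<phi> i j) ` ({..<m} - {k})) \<noteq> syzygies R I n a)"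

definition entry_ideal ::
    "('a, 'r) ring_scheme \<Rightarrow> nat \<Rightarrow> nat \<Rightarrow> (nat \<Rightarrow> nat \<Rightarrow> 'a) \<Rightarrow> 'a set"
  where "entry_ideal R n m \<phi> = genideal R {\<phi> i j |i j. i < n \<and> j < m}"


subsection \<open>The second symmetric power and syzygetic ideals\<close>

text \<open>The second symmetric power of \<open>M\<close> is the free module on symbols \<open>[x,y]\<close> with
  \<open>x, y \<in> carrier M\<close>, modulo bilinearity and symmetry.\<close>

definition sym2_relations ::
    "('a, 'r) ring_scheme \<Rightarrow> ('a, 'b, 'm) module_scheme \<Rightarrow> ('b \<times> 'b \<Rightarrow> 'a) set"
  where "sym2_relations R M =
    (let S = carrier M \<times> carrier M; F = free_module R S; e = basis_vec R S in
      {e (x \<oplus>\<^bsub>M\<^esub> x', y) \<ominus>\<^bsub>F\<^esub> (e (x, y) \<oplus>\<^bsub>F\<^esub> e (x', y)) |x x' y.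
         x \<in> carrier M \<and> x' \<in> carrier M \<and> y \<in> carrier M} \<union>
      {e (x, y \<oplus>\<^bsub>M\<^esub> y') \<ominus>\<^bsub>F\<^esub> (e (x, y) \<oplus>\<^bsub>F\<^esub> e (x, y')) |x y y'.
         x \<in> carrier M \<and> y \<in> carrier M \<and> y' \<in> carrier M} \<union>
      {e (r \<odot>\<^bsub>M\<^esub> x, y) \<ominus>\<^bsub>F\<^esub> r \<odot>\<^bsub>F\<^esub> e (x, y) |r x y.
         r \<in> carrier R \<and> x \<in> carrier M \<and> y \<in> carrier M} \<union>
      {e (x, r \<odot>\<^bsub>M\<^esub> y) \<ominus>\<^bsub>F\<^esub> r \<odot>\<^bsub>F\<^esub> e (x, y) |r x y.
         r \<in> carrier R \<and> x \<in> carrier M \<and> y \<in> carrier M} \<union>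
      {e (x, y) \<ominus>\<^bsub>F\<^esub> e (y, x) |x y. x \<in> carrier M \<and> y \<in> carrier M})"

definition sym2 ::
    "('a, 'r) ring_scheme \<Rightarrow> ('a, 'b, 'm) module_scheme \<Rightarrow> ('a, ('b \<times> 'b \<Rightarrow> 'a) set) module"
  where "sym2 R M =
    (let F = free_module R (carrier M \<times> carrier M) in
      quotient_module R F (submodule_generated R F (sym2_relations R M)))"

text \<open>The linear map sending the symbol \<open>[x,y]\<close> to \<open>x \<otimes> y\<close>. The sum runs over the support,
  as \<open>finsum\<close> is only meaningful on finite sets.\<close>

definition formal_product :: "('a, 'r) ring_scheme \<Rightarrow> 'a set \<Rightarrow> ('a \<times> 'a \<Rightarrow> 'a) \<Rightarrow> 'a"
  where "formal_product R I f =
    (\<Oplus>\<^bsub>R\<^esub>s\<in>{s \<in> I \<times> I. f s \<noteq> \<zero>\<^bsub>R\<^esub>}. f s \<otimes>\<^bsub>R\<^esub> (fst s \<otimes>\<^bsub>R\<^esub> snd s))"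

text \<open>The induced map on cosets, on each of which \<open>formal_product\<close> is constant.\<close>

definition sym2_to_square :: "('a, 'r) ring_scheme \<Rightarrow> 'a set \<Rightarrow> ('a \<times> 'a \<Rightarrow> 'a) set \<Rightarrow> 'a"
  where "sym2_to_square R I C = the_elem (formal_product R I ` C)"

definition delta :: "('a, 'r) ring_scheme \<Rightarrow> 'a set \<Rightarrow> ('a \<times> 'a \<Rightarrow> 'a) set set"
  where "delta R I =
    a_kernel (sym2 R (ideal_module R I)) (ideal_module R (I \<cdot>\<^bsub>R\<^esub> I)) (sym2_to_square R I)"

definition syzygetic :: "('a, 'r) ring_scheme \<Rightarrow> 'a set \<Rightarrow> bool"
  where "syzygetic R I \<longleftrightarrow> delta R I = {\<zero>\<^bsub>sym2 R (ideal_module R I)\<^esub>}"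

end

theory Submission
  imports Defs
begin

text \<open>
  Write \<open>K\<close> for the free module \<open>R\<^sup>n\<close>, \<open>d\<close> for the map \<open>K \<rightarrow> R\<close> that sends the \<open>i\<close>-th basis
  vector to \<open>a i\<close>, \<open>Z\<close> for its kernel and \<open>B\<close> for the Koszul boundaries in \<open>K\<close>. Then
  \<open>H\<^sub>1\<close> is the quotient of \<open>Z\<close> by \<open>B\<close>, so \<open>r\<close> annihilates \<open>H\<^sub>1\<close> iff \<open>r Z \<subseteq> B\<close>, while
  \<open>r\<close> lies in the colon ideal iff \<open>r Z \<subseteq> I K\<close>, because the columns of \<open>\<phi>\<close> generate \<open>Z\<close>.
  The first inclusion is immediate from \<open>B \<subseteq> I K\<close>: a boundary is a combination of the
  vectors \<open>a i e j - a j e i\<close>.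

  For the converse it suffices that \<open>Z \<inter> I K \<subseteq> B\<close> when \<open>I\<close> is syzygetic; this
  reflects the isomorphism of \<open>\<delta>(I)\<close> with the quotient of \<open>Z \<inter> I K\<close> by \<open>B\<close>. Choose for each
  \<open>x \<in> I\<close> some \<open>L x \<in> K\<close> with \<open>d (L x) = x\<close>, and let \<open>[x, y]\<close> go to \<open>y L x\<close>. This is linear
  in \<open>y\<close>, and symmetric modulo \<open>B\<close>, because the Leibniz rule says that \<open>d v u - d u v\<close> is
  up to sign the boundary of \<open>u \<and> v\<close> (\<open>koszul_leibniz\<close>). It therefore kills the relations of the second symmetric power modulo \<open>B\<close>
  (\<open>sym2_relations_in_kernel\<close>). Given \<open>z \<in> Z \<inter> I K\<close>, the element
  \<open>\<Sum> [a i, z i]\<close> of the second symmetric power has product \<open>d z = 0\<close>, so it vanishes since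
  \<open>I\<close> is syzygetic. Hence its image \<open>\<Sum> z i L (a i)\<close> lies in \<open>B\<close>, and it differs from \<open>z\<close>
  by multiples of cycles with coefficients in \<open>I\<close>, which lie in \<open>B\<close> by the Leibniz rule
  again (\<open>syzygetic_cycle_in_submodule\<close>).
\<close>

section \<open>Linear maps and submodules\<close>

locale linear_map = M: module R M + N: module R N
  for R (structure) and M :: "('a, 'b, 'm) module_scheme" and N :: "('a, 'c, 'n) module_scheme" +
  fixes h :: "'b \<Rightarrow> 'c"
  assumes map_closed: "x \<in> carrier M \<Longrightarrow> h x \<in> carrier N"
    and map_add: "x \<in> carrier M \<Longrightarrow> y \<in> carrier M \<Longrightarrow> h (x \<oplus>\<^bsub>M\<^esub> y) = h x \<oplus>\<^bsub>N\<^esub> h y"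
    and map_smult: "r \<in> carrier R \<Longrightarrow> x \<in> carrier M \<Longrightarrow> h (r \<odot>\<^bsub>M\<^esub> x) = r \<odot>\<^bsub>N\<^esub> h x"
begin

lemma map_zero: "h \<zero>\<^bsub>M\<^esub> = \<zero>\<^bsub>N\<^esub>"
  using map_smult[of "\<zero>" "\<zero>\<^bsub>M\<^esub>"] by (simp add: map_closed)

lemma map_uminus:
  assumes "x \<in> carrier M"
  shows "h (\<ominus>\<^bsub>M\<^esub> x) = \<ominus>\<^bsub>N\<^esub> h x"
proof -
  have "h (\<ominus>\<^bsub>M\<^esub> x) = h ((\<ominus> \<one>) \<odot>\<^bsub>M\<^esub> x)"
    using assms by (simp add: M.smult_l_minus)
  then show ?thesis
    using assms by (simp add: map_smult map_closed N.smult_l_minus)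
qed

lemma map_minus:
  "x \<in> carrier M \<Longrightarrow> y \<in> carrier M \<Longrightarrow> h (x \<ominus>\<^bsub>M\<^esub> y) = h x \<ominus>\<^bsub>N\<^esub> h y"
  by (simp add: a_minus_def map_add map_uminus)

lemma map_finsum:
  "g \<in> A \<rightarrow> carrier M \<Longrightarrow> h (\<Oplus>\<^bsub>M\<^esub>i\<in>A. g i) = (\<Oplus>\<^bsub>N\<^esub>i\<in>A. h (g i))"
proof (induction A rule: infinite_finite_induct)
  case (insert x A)
  then have "g \<in> A \<rightarrow> carrier M" "g x \<in> carrier M" "(\<lambda>i. h (g i)) \<in> A \<rightarrow> carrier N"
    using map_closed by (auto simp: Pi_iff)
  with insert show ?case
    by (simp add: M.M.finsum_insert N.M.finsum_insert map_add map_closed M.M.finsum_closed)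
qed (simp_all add: map_zero)

lemma image_submodule: "submodule (h ` carrier M) R N"
proof (rule N.submoduleI)
  show "\<zero>\<^bsub>N\<^esub> \<in> h ` carrier M"
    using map_zero by (metis M.M.zero_closed imageI)
next
  fix x assume "x \<in> h ` carrier M"
  then show "\<ominus>\<^bsub>N\<^esub> x \<in> h ` carrier M"
    by (auto simp: map_uminus[symmetric])
next
  fix x y assume "x \<in> h ` carrier M" "y \<in> h ` carrier M"
  then show "x \<oplus>\<^bsub>N\<^esub> y \<in> h ` carrier M"
    by (auto simp: map_add[symmetric])
next
  fix r x assume "r \<in> carrier R" "x \<in> h ` carrier M"
  then show "r \<odot>\<^bsub>N\<^esub> x \<in> h ` carrier M"
    by (auto simp: map_smult[symmetric])
qed (auto simp: map_closed)

lemma preimage_submodule: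
  assumes "submodule B R N"
  shows "submodule {x \<in> carrier M. h x \<in> B} R M"
proof (rule M.submoduleI)
  show "\<zero>\<^bsub>M\<^esub> \<in> {x \<in> carrier M. h x \<in> B}"
    using subgroup.one_closed[OF submodule.axioms(1)[OF assms]] by (simp add: map_zero)
qed (auto simp: map_uminus map_add map_smult N.submoduleE[OF assms])

end

lemma (in module) zero_in_submodule: "submodule B R M \<Longrightarrow> \<zero>\<^bsub>M\<^esub> \<in> B"
  using subgroup.one_closed[OF submodule.axioms(1)] by fastforce

lemma (in module) submodule_minus:
  "submodule B R M \<Longrightarrow> x \<in> B \<Longrightarrow> y \<in> B \<Longrightarrow> x \<ominus>\<^bsub>M\<^esub> y \<in> B"
  by (simp add: a_minus_def submoduleE)

lemma (in module) submodule_finsum: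
  "submodule B R M \<Longrightarrow> g \<in> A \<rightarrow> B \<Longrightarrow> (\<Oplus>\<^bsub>M\<^esub>i\<in>A. g i) \<in> B"
proof (induction A rule: infinite_finite_induct)
  case (insert x A)
  then have "g \<in> A \<rightarrow> carrier M" "g x \<in> carrier M"
    using submoduleE(1) by blast+
  with insert show ?case
    by (simp add: M.finsum_insert submoduleE)
qed (simp_all add: zero_in_submodule)

lemma (in module) submodule_zero: "submodule {\<zero>\<^bsub>M\<^esub>} R M"
  by (rule submoduleI) simp_all

text \<open>A coset \<open>B + z\<close> is killed by \<open>r\<close> exactly when \<open>r z \<in> B\<close>. With \<open>Z\<close> the cycles and \<open>B\<close> the
  boundaries this turns annihilators of homology into a condition on representatives.\<close>

lemma (in module) annihilator_quotient_module:
  assumes "submodule B R M" "submodule Z R M"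
  shows "annihilator R (quotient_module R (M\<lparr>carrier := Z\<rparr>) B)
    = {r \<in> carrier R. \<forall>z\<in>Z. r \<odot>\<^bsub>M\<^esub> z \<in> B}"
proof -
  note B = submoduleE(1)[OF assms(1)]
  note Z = submoduleE(1)[OF assms(2)]
  have coset: "B +>\<^bsub>M\<lparr>carrier := Z\<rparr>\<^esub> x = B +>\<^bsub>M\<^esub> x" for x
    by (simp add: a_r_coset_def')
  have self: "x \<in> B +>\<^bsub>M\<^esub> x" if "x \<in> carrier M" for x
    using that zero_in_submodule[OF assms(1)] by (force simp: a_r_coset_def')
  have absorb: "B +>\<^bsub>M\<^esub> x = B" if "x \<in> B" for x
    using M.a_coset_join2[of x B] that B submodule.axioms(1)[OF assms(1)] by blast
  have "(\<Union>x\<in>B +>\<^bsub>M\<^esub> z. B +>\<^bsub>M\<^esub> (r \<odot>\<^bsub>M\<^esub> x)) = B \<longleftrightarrow> r \<odot>\<^bsub>M\<^esub> z \<in> B"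
    if r: "r \<in> carrier R" and z: "z \<in> Z" for r z
  proof
    assume "(\<Union>x\<in>B +>\<^bsub>M\<^esub> z. B +>\<^bsub>M\<^esub> (r \<odot>\<^bsub>M\<^esub> x)) = B"
    then show "r \<odot>\<^bsub>M\<^esub> z \<in> B"
      using self[of z] self[of "r \<odot>\<^bsub>M\<^esub> z"] r z Z by blast
  next
    assume rz: "r \<odot>\<^bsub>M\<^esub> z \<in> B"
    have "B +>\<^bsub>M\<^esub> (r \<odot>\<^bsub>M\<^esub> x) = B" if x: "x \<in> B +>\<^bsub>M\<^esub> z" for x
    proof (rule absorb)
      obtain b where "b \<in> B" "x = b \<oplus>\<^bsub>M\<^esub> z"
        using x by (auto simp: a_r_coset_def')
      then show "r \<odot>\<^bsub>M\<^esub> x \<in> B"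
        using rz r z B Z submoduleE(4,5)[OF assms(1)] by (simp add: smult_r_distr subset_iff)
    qed
    moreover have "B +>\<^bsub>M\<^esub> z \<noteq> {}"
      using self z Z by blast
    ultimately show "(\<Union>x\<in>B +>\<^bsub>M\<^esub> z. B +>\<^bsub>M\<^esub> (r \<odot>\<^bsub>M\<^esub> x)) = B"
      by auto
  qed
  then show ?thesis
    unfolding annihilator_def quotient_module_def
    by (intro Collect_cong conj_cong refl) (simp add: A_RCOSETS_def' coset)
qed

section \<open>Free modules\<close>

context cring
begin

lemma free_module_simps:
  "carrier (free_module R S) = {f \<in> S \<rightarrow>\<^sub>E carrier R. finite {s \<in> S. f s \<noteq> \<zero>}}"
  "\<zero>\<^bsub>free_module R S\<^esub> = (\<lambda>s\<in>S. \<zero>)"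
  "f \<oplus>\<^bsub>free_module R S\<^esub> g = (\<lambda>s\<in>S. f s \<oplus> g s)"
  "r \<odot>\<^bsub>free_module R S\<^esub> f = (\<lambda>s\<in>S. r \<otimes> f s)"
  by (simp_all add: free_module_def)

lemma free_module_coeff: "f \<in> carrier (free_module R S) \<Longrightarrow> s \<in> S \<Longrightarrow> f s \<in> carrier R"
  by (auto simp: free_module_simps)

lemma free_module_finite_carrier: "finite S \<Longrightarrow> carrier (free_module R S) = S \<rightarrow>\<^sub>E carrier R"
  by (auto simp: free_module_simps)

lemma free_module_eqI:
  "f \<in> carrier (free_module R S) \<Longrightarrow> g \<in> carrier (free_module R S) \<Longrightarrow>
    (\<And>s. s \<in> S \<Longrightarrow> f s = g s) \<Longrightarrow> f = g"
  by (auto simp: free_module_simps intro: PiE_ext)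

lemma free_module_module: "module R (free_module R S)"
proof (rule moduleI)
  have support: "finite {s \<in> S. h s \<noteq> \<zero>}"
    if "f \<in> carrier (free_module R S)" "g \<in> carrier (free_module R S)"
      "\<And>s. s \<in> S \<Longrightarrow> f s = \<zero> \<Longrightarrow> g s = \<zero> \<Longrightarrow> h s = \<zero>" for f g h
    by (rule finite_subset[of _ "{s \<in> S. f s \<noteq> \<zero>} \<union> {s \<in> S. g s \<noteq> \<zero>}"])
      (use that in \<open>auto simp: free_module_simps\<close>)
  have closed: "f \<oplus>\<^bsub>free_module R S\<^esub> g \<in> carrier (free_module R S)"
    if "f \<in> carrier (free_module R S)" "g \<in> carrier (free_module R S)" for f g
    using support[OF that, of "f \<oplus>\<^bsub>free_module R S\<^esub> g"] that
    by (auto simp: free_module_simps)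
  have smult: "r \<odot>\<^bsub>free_module R S\<^esub> f \<in> carrier (free_module R S)"
    if "r \<in> carrier R" "f \<in> carrier (free_module R S)" for r f
    using support[OF that(2) that(2), of "r \<odot>\<^bsub>free_module R S\<^esub> f"] that
    by (auto simp: free_module_simps)
  show "abelian_group (free_module R S)"
  proof (rule abelian_groupI)
    fix f assume f: "f \<in> carrier (free_module R S)"
    show "\<exists>g\<in>carrier (free_module R S). g \<oplus>\<^bsub>free_module R S\<^esub> f = \<zero>\<^bsub>free_module R S\<^esub>"
    proof
      show "(\<ominus> \<one>) \<odot>\<^bsub>free_module R S\<^esub> f \<in> carrier (free_module R S)"
        using f by (simp add: smult)
      show "((\<ominus> \<one>) \<odot>\<^bsub>free_module R S\<^esub> f) \<oplus>\<^bsub>free_module R S\<^esub> f = \<zero>\<^bsub>free_module R S\<^esub>"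
        using f by (auto simp: free_module_simps l_minus l_neg PiE_iff)
    qed
  qed (use closed in \<open>auto simp: free_module_simps PiE_iff a_ac extensional_def fun_eq_iff\<close>)
  show "cring R" ..
qed (auto simp: free_module_simps PiE_iff l_distr r_distr m_assoc extensional_def fun_eq_iff
      intro: rev_finite_subset)

lemma free_module_a_minus:
  assumes "f \<in> carrier (free_module R S)" "g \<in> carrier (free_module R S)" "s \<in> S"
  shows "(f \<ominus>\<^bsub>free_module R S\<^esub> g) s = f s \<ominus> g s"
proof -
  interpret F: module R "free_module R S" by (rule free_module_module)
  have "\<ominus>\<^bsub>free_module R S\<^esub> g = (\<ominus> \<one>) \<odot>\<^bsub>free_module R S\<^esub> g"
    using assms by (simp add: F.smult_l_minus)
  then have "(\<ominus>\<^bsub>free_module R S\<^esub> g) s = \<ominus> (g s)"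
    using assms by (simp add: free_module_simps l_minus PiE_iff)
  then show ?thesis
    using assms by (simp add: a_minus_def free_module_simps)
qed

lemma basis_vec_closed: "s \<in> S \<Longrightarrow> basis_vec R S s \<in> carrier (free_module R S)"
  by (auto simp: basis_vec_def free_module_simps intro: finite_subset[of _ "{s}"])

lemma finsum_basis_vec:
  assumes "finite A" "j \<in> A" "g \<in> A \<rightarrow> carrier R"
  shows "(\<Oplus>k\<in>A. g k \<otimes> basis_vec R A j k) = g j"
proof -
  have "(\<Oplus>k\<in>A. g k \<otimes> basis_vec R A j k) = (\<Oplus>k\<in>A. if j = k then g k else \<zero>)"
    using assms(3) by (intro finsum_cong') (auto simp: basis_vec_def Pi_iff)
  also have "\<dots> = g j"
    using assms by (intro finsum_singleton)
  finally show ?thesis .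
qed

text \<open>The ring as a module over itself, so that linear forms are instances of \<open>linear_map\<close>.\<close>

abbreviation "regular_module \<equiv> ideal_module R (carrier R)"

lemma ideal_module_simps:
  "carrier (ideal_module R I) = I" "\<zero>\<^bsub>ideal_module R I\<^esub> = \<zero>"
  "x \<oplus>\<^bsub>ideal_module R I\<^esub> y = x \<oplus> y" "r \<odot>\<^bsub>ideal_module R I\<^esub> x = r \<otimes> x"
  by (simp_all add: ideal_module_def)

lemma ideal_module_module:
  assumes "ideal I R"
  shows "module R (ideal_module R I)"
proof (rule moduleI)
  interpret I: ideal I R by (rule assms)
  show "abelian_group (ideal_module R I)"
  proof (rule abelian_groupI)
    show "\<exists>y\<in>carrier (ideal_module R I). y \<oplus>\<^bsub>ideal_module R I\<^esub> x = \<zero>\<^bsub>ideal_module R I\<^esub>"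
      if "x \<in> carrier (ideal_module R I)" for x
      using that by (intro bexI[of _ "\<ominus> x"]) (auto simp: ideal_module_simps l_neg I.Icarr)
  qed (auto simp: ideal_module_simps I.Icarr a_ac)
  show "cring R" ..
  show "a \<odot>\<^bsub>ideal_module R I\<^esub> x \<in> carrier (ideal_module R I)"
    if "a \<in> carrier R" "x \<in> carrier (ideal_module R I)" for a x
    using that by (simp add: ideal_module_simps I.I_l_closed)
qed (use ideal.Icarr[OF assms] in \<open>auto simp: ideal_module_simps l_distr r_distr m_assoc\<close>)

lemma regular_module_module: "module R regular_module"
  by (rule ideal_module_module[OF oneideal])

lemma finsum_regular_module: "finsum regular_module = finsum R"
  by (intro ext) (simp add: finsum_def finprod_def ideal_module_def)

lemma coeff_linear_map:
  assumes "s \<in> S"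
  shows "linear_map R (free_module R S) regular_module (\<lambda>f. f s)"
  by (intro linear_map.intro free_module_module regular_module_module linear_map_axioms.intro)
    (use assms in \<open>auto simp: ideal_module_simps free_module_simps\<close>)

lemma basis_expansion:
  assumes S: "finite S" and f: "f \<in> carrier (free_module R S)"
  shows "f = (\<Oplus>\<^bsub>free_module R S\<^esub>s\<in>S. f s \<odot>\<^bsub>free_module R S\<^esub> basis_vec R S s)"
proof -
  interpret F: module R "free_module R S" by (rule free_module_module)
  have summands: "(\<lambda>s. f s \<odot>\<^bsub>free_module R S\<^esub> basis_vec R S s) \<in> S \<rightarrow> carrier (free_module R S)"
    using f by (intro Pi_I F.smult_closed basis_vec_closed free_module_coeff[of f S])
  have "f t = (\<Oplus>\<^bsub>free_module R S\<^esub>s\<in>S. f s \<odot>\<^bsub>free_module R S\<^esub> basis_vec R S s) t"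
    if t: "t \<in> S" for t
  proof -
    interpret c: linear_map R "free_module R S" regular_module "\<lambda>f. f t"
      by (rule coeff_linear_map[OF t])
    have "(\<Oplus>\<^bsub>free_module R S\<^esub>s\<in>S. f s \<odot>\<^bsub>free_module R S\<^esub> basis_vec R S s) t
      = (\<Oplus>s\<in>S. f s \<otimes> basis_vec R S s t)"
      using summands t
      by (simp add: c.map_finsum finsum_regular_module free_module_simps(4))
    also have "\<dots> = (\<Oplus>s\<in>S. if t = s then f s else \<zero>)"
      using f t by (intro finsum_cong') (auto simp: basis_vec_def free_module_coeff)
    also have "\<dots> = f t"
      using f t S by (intro finsum_singleton) (auto simp: free_module_coeff)
    finally show ?thesis by simp
  qed
  moreover have "(\<Oplus>\<^bsub>free_module R S\<^esub>s\<in>S. f s \<odot>\<^bsub>free_module R S\<^esub> basis_vec R S s)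
      \<in> carrier (free_module R S)"
    using summands by (rule F.finsum_closed)
  ultimately show ?thesis
    using f by (intro free_module_eqI) auto
qed

text \<open>The linear map from the free module on \<open>S\<close> that sends the basis vector of \<open>s\<close> to \<open>g s\<close>.
  Summing over the support keeps the sum finite, and makes \<open>formal_product\<close> an instance.\<close>

definition linear_ext ::
    "('a, 'c, 'm) module_scheme \<Rightarrow> 'i set \<Rightarrow> ('i \<Rightarrow> 'c) \<Rightarrow> ('i \<Rightarrow> 'a) \<Rightarrow> 'c"
  where "linear_ext P S g f = (\<Oplus>\<^bsub>P\<^esub>s\<in>{s \<in> S. f s \<noteq> \<zero>}. f s \<odot>\<^bsub>P\<^esub> g s)"

text \<open>Additivity needs one index set for two elements with different supports.\<close>

lemma linear_ext_superset:
  assumes P: "module R P" and g: "g \<in> S \<rightarrow> carrier P" and f: "f \<in> carrier (free_module R S)"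
    and A: "finite A" "{s \<in> S. f s \<noteq> \<zero>} \<subseteq> A" "A \<subseteq> S"
  shows "linear_ext P S g f = (\<Oplus>\<^bsub>P\<^esub>s\<in>A. f s \<odot>\<^bsub>P\<^esub> g s)"
proof -
  interpret P: module R P by (rule P)
  have "f s \<in> carrier R" "g s \<in> carrier P" if "s \<in> A" for s
    using that A g f by (auto simp: free_module_simps PiE_iff)
  then show ?thesis
    unfolding linear_ext_def using A
    by (intro P.M.add.finprod_mono_neutral_cong_left) auto
qed

lemma linear_ext_linear_map:
  assumes P: "module R P" and g: "g \<in> S \<rightarrow> carrier P"
  shows "linear_map R (free_module R S) P (linear_ext P S g)"
proof (intro linear_map.intro free_module_module P linear_map_axioms.intro)
  interpret P: module R P by (rule P)
  interpret F: module R "free_module R S" by (rule free_module_module)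
  note coeff = free_module_coeff[of _ S]
  have g': "g s \<in> carrier P" if "s \<in> S" for s
    using that g by auto
  show "linear_ext P S g f \<in> carrier P" if "f \<in> carrier (free_module R S)" for f
    unfolding linear_ext_def using that by (intro P.finsum_closed) (auto simp: coeff g')
  show "linear_ext P S g (f \<oplus>\<^bsub>free_module R S\<^esub> f') = linear_ext P S g f \<oplus>\<^bsub>P\<^esub> linear_ext P S g f'"
    if f: "f \<in> carrier (free_module R S)" "f' \<in> carrier (free_module R S)" for f f'
  proof -
    \<comment> \<open>The supports of both summands and of their sum lie in \<open>?A\<close>.\<close>
    let ?A = "{s \<in> S. f s \<noteq> \<zero>} \<union> {s \<in> S. f' s \<noteq> \<zero>}"
    have A: "finite ?A" "?A \<subseteq> S"
      using f by (auto simp: free_module_simps)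
    have "linear_ext P S g (f \<oplus>\<^bsub>free_module R S\<^esub> f')
      = (\<Oplus>\<^bsub>P\<^esub>s\<in>?A. (f \<oplus>\<^bsub>free_module R S\<^esub> f') s \<odot>\<^bsub>P\<^esub> g s)"
      using f A by (intro linear_ext_superset P g F.a_closed) (auto simp: free_module_simps)
    also have "\<dots> = (\<Oplus>\<^bsub>P\<^esub>s\<in>?A. f s \<odot>\<^bsub>P\<^esub> g s \<oplus>\<^bsub>P\<^esub> f' s \<odot>\<^bsub>P\<^esub> g s)"
      using f by (intro P.finsum_cong') (auto simp: free_module_simps(3) coeff g' P.smult_l_distr)
    also have "\<dots> = (\<Oplus>\<^bsub>P\<^esub>s\<in>?A. f s \<odot>\<^bsub>P\<^esub> g s) \<oplus>\<^bsub>P\<^esub> (\<Oplus>\<^bsub>P\<^esub>s\<in>?A. f' s \<odot>\<^bsub>P\<^esub> g s)"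
      using f by (intro P.finsum_addf) (auto simp: coeff g')
    also have "\<dots> = linear_ext P S g f \<oplus>\<^bsub>P\<^esub> linear_ext P S g f'"
      using f A linear_ext_superset[OF P g, of _ ?A] by simp
    finally show ?thesis .
  qed
  show "linear_ext P S g (r \<odot>\<^bsub>free_module R S\<^esub> f) = r \<odot>\<^bsub>P\<^esub> linear_ext P S g f"
    if r: "r \<in> carrier R" and f: "f \<in> carrier (free_module R S)" for r f
  proof -
    let ?A = "{s \<in> S. f s \<noteq> \<zero>}"
    have A: "finite ?A" "?A \<subseteq> S"
      using f by (auto simp: free_module_simps)
    have "linear_ext P S g (r \<odot>\<^bsub>free_module R S\<^esub> f)
      = (\<Oplus>\<^bsub>P\<^esub>s\<in>?A. (r \<odot>\<^bsub>free_module R S\<^esub> f) s \<odot>\<^bsub>P\<^esub> g s)"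
      using r f A by (intro linear_ext_superset P g F.smult_closed) (auto simp: free_module_simps)
    also have "\<dots> = (\<Oplus>\<^bsub>P\<^esub>s\<in>?A. r \<odot>\<^bsub>P\<^esub> (f s \<odot>\<^bsub>P\<^esub> g s))"
      using r f by (intro P.finsum_cong') (auto simp: free_module_simps(4) coeff g' P.smult_assoc1)
    also have "\<dots> = r \<odot>\<^bsub>P\<^esub> linear_ext P S g f"
      unfolding linear_ext_def using r f A
      by (intro P.finsum_smult_ldistr[symmetric]) (auto simp: coeff g')
    finally show ?thesis .
  qed
qed

lemma linear_ext_basis_vec:
  assumes P: "module R P" and g: "g \<in> S \<rightarrow> carrier P" and s: "s \<in> S"
  shows "linear_ext P S g (basis_vec R S s) = g s"
proof -
  interpret P: module R P by (rule P)
  have "linear_ext P S g (basis_vec R S s) = (\<Oplus>\<^bsub>P\<^esub>t\<in>{s}. basis_vec R S s t \<odot>\<^bsub>P\<^esub> g t)"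
    using s by (intro linear_ext_superset P g basis_vec_closed) (auto simp: basis_vec_def split: if_splits)
  also have "\<dots> = g s"
    using s g by (simp add: basis_vec_def Pi_iff)
  finally show ?thesis .
qed

end

section \<open>The second symmetric power\<close>

lemma (in abelian_group) minus_minus_cancel:
  assumes "x \<in> carrier G" "y \<in> carrier G" "z \<in> carrier G"
  shows "x \<ominus> y = (x \<ominus> z) \<ominus> (y \<ominus> z)"
proof -
  have "(x \<ominus> z) \<ominus> (y \<ominus> z) = x \<oplus> (\<ominus> z \<oplus> (z \<oplus> \<ominus> y))"
    using assms by (simp add: minus_eq minus_add a_assoc a_comm[of "\<ominus> y" z])
  then show ?thesis
    using assms by (simp add: minus_eq r_neg1)
qed

lemma (in abelian_group) add_minus_add:
  assumes "x \<in> carrier G" "y \<in> carrier G" "z \<in> carrier G" "w \<in> carrier G"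
  shows "(x \<oplus> y) \<ominus> (z \<oplus> w) = (x \<ominus> z) \<oplus> (y \<ominus> w)"
  using assms by (simp add: minus_eq minus_add a_ac)

context cring
begin

text \<open>The universal property of the second symmetric power, relative to a submodule \<open>B\<close> of
  the target. Linearity is exact in the second argument; modulo \<open>B\<close>, symmetry
  carries it over to the first. This matters below, where \<open>g\<close> involves an arbitrary
  choice in its first argument and is linear there only up to boundaries.\<close>

lemma sym2_relations_in_kernel:
  assumes M: "module R M" and P: "module R P" and B: "submodule B R P"
    and closed: "g \<in> carrier M \<times> carrier M \<rightarrow> carrier P"
    and add: "\<And>x y y'. x \<in> carrier M \<Longrightarrow> y \<in> carrier M \<Longrightarrow> y' \<in> carrier M \<Longrightarrow>
      g (x, y \<oplus>\<^bsub>M\<^esub> y') = g (x, y) \<oplus>\<^bsub>P\<^esub> g (x, y')"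
    and smult: "\<And>r x y. r \<in> carrier R \<Longrightarrow> x \<in> carrier M \<Longrightarrow> y \<in> carrier M \<Longrightarrow>
      g (x, r \<odot>\<^bsub>M\<^esub> y) = r \<odot>\<^bsub>P\<^esub> g (x, y)"
    and sym: "\<And>x y. x \<in> carrier M \<Longrightarrow> y \<in> carrier M \<Longrightarrow> g (x, y) \<ominus>\<^bsub>P\<^esub> g (y, x) \<in> B"
  defines "S \<equiv> carrier M \<times> carrier M"
  assumes f: "f \<in> submodule_generated R (free_module R S) (sym2_relations R M)"
  shows "f \<in> carrier (free_module R S)" and "linear_ext P S g f \<in> B"
proof -
  interpret M: module R M by (rule M)
  interpret P: module R P by (rule P)
  interpret F: module R "free_module R S" by (rule free_module_module)
  have g: "g \<in> S \<rightarrow> carrier P"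
    using closed by (simp add: S_def)
  interpret G: linear_map R "free_module R S" P "linear_ext P S g"
    by (rule linear_ext_linear_map[OF P g])
  define e where "e = basis_vec R S"
  have e: "e (x, y) \<in> carrier (free_module R S)" "linear_ext P S g (e (x, y)) = g (x, y)"
    "g (x, y) \<in> carrier P" if "x \<in> carrier M" "y \<in> carrier M" for x y
    using that g by (auto simp: S_def e_def basis_vec_closed linear_ext_basis_vec[OF P g[unfolded S_def]])
  note G = e F.minus_closed F.a_closed F.smult_closed G.map_minus G.map_add G.map_smult
  note in_B = P.submoduleE(4,5)[OF B] P.submodule_minus[OF B] P.zero_in_submodule[OF B]
  have add_left: "g (x \<oplus>\<^bsub>M\<^esub> x', y) \<ominus>\<^bsub>P\<^esub> (g (x, y) \<oplus>\<^bsub>P\<^esub> g (x', y)) \<in> B"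
    if x: "x \<in> carrier M" "x' \<in> carrier M" "y \<in> carrier M" for x x' y
  proof -
    have "g (x \<oplus>\<^bsub>M\<^esub> x', y) \<ominus>\<^bsub>P\<^esub> (g (x, y) \<oplus>\<^bsub>P\<^esub> g (x', y))
      = (g (x \<oplus>\<^bsub>M\<^esub> x', y) \<ominus>\<^bsub>P\<^esub> g (y, x \<oplus>\<^bsub>M\<^esub> x'))
        \<ominus>\<^bsub>P\<^esub> ((g (x, y) \<oplus>\<^bsub>P\<^esub> g (x', y)) \<ominus>\<^bsub>P\<^esub> g (y, x \<oplus>\<^bsub>M\<^esub> x'))"
      using e(3) x by (intro P.minus_minus_cancel) auto
    also have "(g (x, y) \<oplus>\<^bsub>P\<^esub> g (x', y)) \<ominus>\<^bsub>P\<^esub> g (y, x \<oplus>\<^bsub>M\<^esub> x')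
      = (g (x, y) \<ominus>\<^bsub>P\<^esub> g (y, x)) \<oplus>\<^bsub>P\<^esub> (g (x', y) \<ominus>\<^bsub>P\<^esub> g (y, x'))"
      using e(3) x by (simp add: add P.add_minus_add)
    finally show ?thesis
      using x sym in_B by simp
  qed
  have smult_left: "g (r \<odot>\<^bsub>M\<^esub> x, y) \<ominus>\<^bsub>P\<^esub> r \<odot>\<^bsub>P\<^esub> g (x, y) \<in> B"
    if x: "r \<in> carrier R" "x \<in> carrier M" "y \<in> carrier M" for r x y
  proof -
    have "g (r \<odot>\<^bsub>M\<^esub> x, y) \<ominus>\<^bsub>P\<^esub> r \<odot>\<^bsub>P\<^esub> g (x, y)
      = (g (r \<odot>\<^bsub>M\<^esub> x, y) \<ominus>\<^bsub>P\<^esub> g (y, r \<odot>\<^bsub>M\<^esub> x))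
        \<ominus>\<^bsub>P\<^esub> (r \<odot>\<^bsub>P\<^esub> g (x, y) \<ominus>\<^bsub>P\<^esub> g (y, r \<odot>\<^bsub>M\<^esub> x))"
      using e(3) x by (intro P.minus_minus_cancel) auto
    also have "r \<odot>\<^bsub>P\<^esub> g (x, y) \<ominus>\<^bsub>P\<^esub> g (y, r \<odot>\<^bsub>M\<^esub> x)
      = r \<odot>\<^bsub>P\<^esub> (g (x, y) \<ominus>\<^bsub>P\<^esub> g (y, x))"
      using e(3) x by (simp add: smult P.minus_eq P.smult_r_distr P.smult_r_minus)
    finally show ?thesis
      using x sym in_B by simp
  qed
  have "sym2_relations R M \<subseteq> {f \<in> carrier (free_module R S). linear_ext P S g f \<in> B}"
    unfolding sym2_relations_def Let_def S_def[symmetric] e_def[symmetric]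
    using add_left smult_left sym in_B(4) by (auto simp: G add smult P.minus_eq P.r_neg)
  then have "f \<in> {f \<in> carrier (free_module R S). linear_ext P S g f \<in> B}"
    using f G.preimage_submodule[OF B] unfolding submodule_generated_def by blast
  then show "f \<in> carrier (free_module R S)" "linear_ext P S g f \<in> B"
    by auto
qed

lemma formal_product_linear_ext:
  "formal_product R I = linear_ext regular_module (I \<times> I) (\<lambda>s. fst s \<otimes> snd s)"
  by (simp add: fun_eq_iff formal_product_def linear_ext_def finsum_regular_module ideal_module_simps)

text \<open>What being syzygetic means for representatives. The map \<open>sym2_to_square\<close> is computed on a
  coset from any representative, since formal products vanish on the relations; this is
  \<open>sym2_relations_in_kernel\<close> for the multiplication of \<open>R\<close> and \<open>B = {\<zero>}\<close>.\<close>

lemma syzygetic_product_zero: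
  assumes I: "ideal I R" and syz: "syzygetic R I"
    and f: "f \<in> carrier (free_module R (I \<times> I))" and zero: "formal_product R I f = \<zero>"
  shows "f \<in> submodule_generated R (free_module R (I \<times> I)) (sym2_relations R (ideal_module R I))"
proof -
  define F N where "F = free_module R (I \<times> I)"
    and "N = submodule_generated R F (sym2_relations R (ideal_module R I))"
  interpret F: module R F unfolding F_def by (rule free_module_module)
  interpret I: module R "ideal_module R I" by (rule ideal_module_module[OF I])
  note carr = ideal.Icarr[OF I]
  have mult: "(\<lambda>s. fst s \<otimes> snd s) \<in> I \<times> I \<rightarrow> carrier regular_module"
    by (auto simp: ideal_module_simps carr)
  interpret p: linear_map R F regular_module "formal_product R I"
    unfolding formal_product_linear_ext F_def
    by (rule linear_ext_linear_map[OF regular_module_module mult])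
  have N: "h \<in> carrier F" "formal_product R I h = \<zero>" if "h \<in> N" for h
  proof -
    have h: "h \<in> submodule_generated R (free_module R (carrier (ideal_module R I) \<times>
        carrier (ideal_module R I))) (sym2_relations R (ideal_module R I))"
      using that by (simp add: N_def F_def ideal_module_simps)
    have *: "submodule {\<zero>} R regular_module"
      using p.N.submodule_zero by (simp add: ideal_module_simps)
    have "x \<otimes> y \<ominus>\<^bsub>regular_module\<^esub> (y \<otimes> x) \<in> {\<zero>}" if "x \<in> I" "y \<in> I" for x y
      using that carr m_comm[of x y] p.N.r_neg[of "x \<otimes> y"]
      by (simp add: p.N.minus_eq ideal_module_simps)
    note vanish = sym2_relations_in_kernel[OF I.module_axioms regular_module_module *,
        of "\<lambda>s. fst s \<otimes> snd s", OF _ _ _ _ h, simplified ideal_module_simps fst_conv snd_conv,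
        OF mult[simplified ideal_module_simps] _ _ this]
    have "h \<in> carrier F" "formal_product R I h \<in> {\<zero>}"
      unfolding F_def formal_product_linear_ext
      by (rule vanish; simp add: carr r_distr m_lcomm)+
    then show "h \<in> carrier F" "formal_product R I h = \<zero>" by auto
  qed
  have N0: "\<zero>\<^bsub>F\<^esub> \<in> N"
    unfolding N_def submodule_generated_def using F.zero_in_submodule by blast
  define C where "C = N +>\<^bsub>F\<^esub> f"
  have f': "f \<in> carrier F"
    using f by (simp add: F_def)
  have fC: "f \<in> C"
    using N0 f' unfolding C_def a_r_coset_def' by force
  have "formal_product R I h = \<zero>" if "h \<in> C" for h
    using that f' zero N by (auto simp: C_def a_r_coset_def' p.map_add ideal_module_simps)
  then have "formal_product R I ` C = {\<zero>}"
    using fC by auto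
  moreover have "C \<in> carrier (sym2 R (ideal_module R I))"
    using f' by (auto simp: sym2_def Let_def quotient_module_def ideal_module_simps A_RCOSETS_def'
        C_def F_def N_def)
  ultimately have "C \<in> delta R I"
    by (simp add: delta_def a_kernel_def kernel_def sym2_to_square_def ideal_module_simps)
  then have "C = N"
    using syz by (simp add: syzygetic_def sym2_def Let_def quotient_module_def ideal_module_simps
        N_def F_def)
  then show ?thesis
    using fC by (simp add: N_def F_def)
qed

text \<open>The heart of the converse inclusion: a cycle \<open>z\<close> with coordinates in \<open>I\<close> lies in \<open>B\<close>. The
  Koszul complex enters only through the hypothesis \<open>koszul\<close>, which has two uses. With
  \<open>u\<close>, \<open>v\<close> lifts of elements of \<open>I\<close> it makes \<open>y L x\<close> symmetric modulo \<open>B\<close>; with \<open>u\<close> a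
  cycle it reads \<open>d v u \<in> B\<close>, so elements of \<open>I\<close> carry cycles into \<open>B\<close>.\<close>

lemma syzygetic_cycle_in_submodule:
  fixes d :: "('i \<Rightarrow> 'a) \<Rightarrow> 'a"
  assumes I: "ideal I R" and syz: "syzygetic R I" and S: "finite S"
  defines "F \<equiv> free_module R S"
  assumes d: "linear_map R F regular_module d" and image: "d ` carrier F = I"
    and B: "submodule B R F"
    and koszul: "\<And>u v. u \<in> carrier F \<Longrightarrow> v \<in> carrier F \<Longrightarrow>
      d v \<odot>\<^bsub>F\<^esub> u \<ominus>\<^bsub>F\<^esub> d u \<odot>\<^bsub>F\<^esub> v \<in> B"
    and z: "z \<in> carrier F" "d z = \<zero>" and zI: "\<And>s. s \<in> S \<Longrightarrow> z s \<in> I"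
  shows "z \<in> B"
proof -
  interpret d: linear_map R F regular_module d by (rule d)
  interpret I: module R "ideal_module R I" by (rule ideal_module_module[OF I])
  note carr = ideal.Icarr[OF I]
  note in_B = d.M.submoduleE(4,5)[OF B] d.M.submodule_minus[OF B] d.M.submodule_finsum[OF B]
  define e where "e = basis_vec R S"
  have e: "e s \<in> carrier F" if "s \<in> S" for s
    using that by (simp add: e_def F_def basis_vec_closed)
  define L where "L = inv_into (carrier F) d"
  have L: "L x \<in> carrier F" "d (L x) = x" if "x \<in> I" for x
    using that image by (auto simp: L_def inv_into_into f_inv_into_f)
  have dI: "d u \<in> I" if "u \<in> carrier F" for u
    using that image by blast
  define g where "g = (\<lambda>(x, y). y \<odot>\<^bsub>F\<^esub> L x)"
  have g: "g \<in> I \<times> I \<rightarrow> carrier F"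
    using L carr by (auto simp: g_def)
  define W where "W = free_module R (I \<times> I)"
  interpret W: module R W unfolding W_def by (rule free_module_module)
  interpret G: linear_map R W F "linear_ext F (I \<times> I) g"
    unfolding W_def by (rule linear_ext_linear_map[OF d.M.module_axioms g])
  have mult: "(\<lambda>s. fst s \<otimes> snd s) \<in> I \<times> I \<rightarrow> carrier regular_module"
    by (auto simp: ideal_module_simps carr)
  interpret p: linear_map R W regular_module "formal_product R I"
    unfolding formal_product_linear_ext W_def
    by (rule linear_ext_linear_map[OF regular_module_module mult])
  \<comment> \<open>\<open>w\<close> represents \<open>\<Sum> [d (e s), z s]\<close>; its product is \<open>d z\<close>, and \<open>g\<close> sends it to \<open>z\<close>
    with each basis vector \<open>e s\<close> replaced by the chosen lift of \<open>d (e s)\<close>.\<close>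
  define w where "w = (\<Oplus>\<^bsub>W\<^esub>s\<in>S. basis_vec R (I \<times> I) (d (e s), z s))"
  have pair: "(d (e s), z s) \<in> I \<times> I" if "s \<in> S" for s
    using that dI e zI by simp
  have bW: "(\<lambda>s. basis_vec R (I \<times> I) (d (e s), z s)) \<in> S \<rightarrow> carrier W"
    using pair unfolding W_def by (intro Pi_I basis_vec_closed)
  have w: "w \<in> carrier W"
    unfolding w_def using bW by (rule W.finsum_closed)
  have z_sum: "z = (\<Oplus>\<^bsub>F\<^esub>s\<in>S. z s \<odot>\<^bsub>F\<^esub> e s)"
    using basis_expansion[OF S, of z] z(1) by (simp add: F_def e_def)
  have "formal_product R I w = (\<Oplus>s\<in>S. d (e s) \<otimes> z s)"
    unfolding w_def p.map_finsum[OF bW] finsum_regular_module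
    using pair carr
    by (intro finsum_cong')
       (auto simp: formal_product_linear_ext linear_ext_basis_vec[OF regular_module_module mult])
  also have "\<dots> = (\<Oplus>s\<in>S. d (z s \<odot>\<^bsub>F\<^esub> e s))"
    using e carr zI dI
    by (intro finsum_cong') (auto simp: d.map_smult ideal_module_simps m_comm)
  also have "\<dots> = d (\<Oplus>\<^bsub>F\<^esub>s\<in>S. z s \<odot>\<^bsub>F\<^esub> e s)"
    using e carr zI by (subst d.map_finsum) (auto simp: finsum_regular_module)
  also have "\<dots> = \<zero>"
    using z(2) z_sum by simp
  finally have "w \<in> submodule_generated R W (sym2_relations R (ideal_module R I))"
    using syzygetic_product_zero[OF I syz] w by (simp add: W_def)
  then have w_rel: "w \<in> submodule_generated R (free_module R (carrier (ideal_module R I) \<times>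
      carrier (ideal_module R I))) (sym2_relations R (ideal_module R I))"
    by (simp add: W_def ideal_module_simps)
  have g_sym: "g (x, y) \<ominus>\<^bsub>F\<^esub> g (y, x) \<in> B" if "x \<in> I" "y \<in> I" for x y
    using koszul[of "L x" "L y"] that L by (simp add: g_def)
  have "linear_ext F (carrier (ideal_module R I) \<times> carrier (ideal_module R I)) g w \<in> B"
    by (rule sym2_relations_in_kernel(2)[OF I.module_axioms d.M.module_axioms B _ _ _ _ w_rel])
      (use g g_sym in \<open>simp_all add: ideal_module_simps g_def L carr d.M.smult_l_distr d.M.smult_assoc1\<close>)
  then have "linear_ext F (I \<times> I) g w \<in> B"
    by (simp add: ideal_module_simps)
  also have "linear_ext F (I \<times> I) g w = (\<Oplus>\<^bsub>F\<^esub>s\<in>S. z s \<odot>\<^bsub>F\<^esub> L (d (e s)))"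
    unfolding w_def G.map_finsum[OF bW]
    using pair carr L
    by (intro d.M.finsum_cong')
      (auto simp: linear_ext_basis_vec[OF d.M.module_axioms g] g_def[THEN fun_cong])
  finally have lifted: "(\<Oplus>\<^bsub>F\<^esub>s\<in>S. z s \<odot>\<^bsub>F\<^esub> L (d (e s))) \<in> B" .
  \<comment> \<open>The replacement changes \<open>z\<close> by an element of \<open>B\<close>: \<open>e s\<close> and its substitute differ by a
    cycle, and \<open>z s \<in> I\<close>.\<close>
  have "z s \<odot>\<^bsub>F\<^esub> (e s \<ominus>\<^bsub>F\<^esub> L (d (e s))) \<in> B" if s: "s \<in> S" for s
  proof -
    obtain v where v: "v \<in> carrier F" "z s = d v"
      using zI[OF s] image by blast
    let ?c = "e s \<ominus>\<^bsub>F\<^esub> L (d (e s))"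
    have c: "?c \<in> carrier F" "d ?c = \<zero>"
      using e[OF s] dI[OF e[OF s]] L d.N.r_neg[of "d (e s)"] d.map_closed[OF e[OF s]]
      by (auto simp: d.map_minus d.N.minus_eq ideal_module_simps)
    have vs: "d v \<in> carrier R"
      using dI v carr by simp
    have "d v \<odot>\<^bsub>F\<^esub> ?c \<ominus>\<^bsub>F\<^esub> d ?c \<odot>\<^bsub>F\<^esub> v = d v \<odot>\<^bsub>F\<^esub> ?c"
      unfolding c(2) using v(1) c(1) vs by (simp add: d.M.minus_eq)
    then show ?thesis
      using koszul[OF c(1) v(1)] v(2) by simp
  qed
  then have "(\<Oplus>\<^bsub>F\<^esub>s\<in>S. z s \<odot>\<^bsub>F\<^esub> (e s \<ominus>\<^bsub>F\<^esub> L (d (e s)))) \<in> B"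
    by (intro in_B(4)) auto
  with lifted have "(\<Oplus>\<^bsub>F\<^esub>s\<in>S. z s \<odot>\<^bsub>F\<^esub> L (d (e s))) \<oplus>\<^bsub>F\<^esub>
      (\<Oplus>\<^bsub>F\<^esub>s\<in>S. z s \<odot>\<^bsub>F\<^esub> (e s \<ominus>\<^bsub>F\<^esub> L (d (e s)))) \<in> B"
    by (rule in_B(2))
  also have "(\<Oplus>\<^bsub>F\<^esub>s\<in>S. z s \<odot>\<^bsub>F\<^esub> L (d (e s))) \<oplus>\<^bsub>F\<^esub>
      (\<Oplus>\<^bsub>F\<^esub>s\<in>S. z s \<odot>\<^bsub>F\<^esub> (e s \<ominus>\<^bsub>F\<^esub> L (d (e s))))
    = (\<Oplus>\<^bsub>F\<^esub>s\<in>S. z s \<odot>\<^bsub>F\<^esub> L (d (e s)) \<oplus>\<^bsub>F\<^esub> z s \<odot>\<^bsub>F\<^esub> (e s \<ominus>\<^bsub>F\<^esub> L (d (e s))))"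
    using e L dI zI carr by (intro d.M.finsum_addf[symmetric]) auto
  also have "\<dots> = (\<Oplus>\<^bsub>F\<^esub>s\<in>S. z s \<odot>\<^bsub>F\<^esub> e s)"
    using e L dI zI carr
    by (intro d.M.finsum_cong')
      (auto simp: d.M.smult_r_distr[symmetric] d.M.minus_eq d.M.a_ac d.M.r_neg)
  finally show ?thesis
    using z_sum by simp
qed

end

section \<open>Colon ideals\<close>

context cring
begin

lemma ideal_finsum: "ideal I R \<Longrightarrow> g \<in> A \<rightarrow> I \<Longrightarrow> (\<Oplus>i\<in>A. g i) \<in> I"
proof (induction A rule: infinite_finite_induct)
  case (insert x A)
  then have "g \<in> A \<rightarrow> carrier R" "g x \<in> carrier R"
    using ideal.Icarr by fastforce+
  with insert show ?case
    by (simp add: finsum_insert additive_subgroup.a_closed[OF ideal.axioms(1)])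
qed (simp_all add: additive_subgroup.zero_closed[OF ideal.axioms(1)])

text \<open>The elements that \<open>r\<close> multiplies into \<open>I\<close> form an ideal, so generators suffice.\<close>

lemma ideal_colon_genideal:
  assumes I: "ideal I R" and X: "X \<subseteq> carrier R"
  shows "ideal_colon R I (genideal R X) = {r \<in> carrier R. \<forall>x\<in>X. r \<otimes> x \<in> I}"
proof -
  interpret I: ideal I R by (rule I)
  have "r \<otimes> y \<in> I" if r: "r \<in> carrier R" "\<forall>x\<in>X. r \<otimes> x \<in> I" and y: "y \<in> genideal R X" for r y
  proof -
    have "ideal {x \<in> carrier R. r \<otimes> x \<in> I} R"
    proof (rule idealI[OF ring_axioms])
      show "subgroup {x \<in> carrier R. r \<otimes> x \<in> I} (add_monoid R)"
        by (rule add.subgroupI) (use r(1) in \<open>auto simp: r_distr r_minus\<close>)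
      show "x \<otimes> b \<in> {x \<in> carrier R. r \<otimes> x \<in> I}" "b \<otimes> x \<in> {x \<in> carrier R. r \<otimes> x \<in> I}"
        if "b \<in> {x \<in> carrier R. r \<otimes> x \<in> I}" "x \<in> carrier R" for b x
        using that r(1) I.I_l_closed[of "r \<otimes> b" x] I.I_r_closed[of "r \<otimes> b" x]
        by (simp_all add: m_assoc m_lcomm[of x r b])
    qed
    moreover have "X \<subseteq> {x \<in> carrier R. r \<otimes> x \<in> I}"
      using r(2) X by auto
    ultimately show ?thesis
      using genideal_minimal y by blast
  qed
  then show ?thesis
    using genideal_self[OF X] by (auto simp: ideal_colon_def)
qed

end

section \<open>The Koszul complex in low degrees\<close>

context cring
begin

lemma koszul_index_finite: "finite {T. T \<subseteq> {..<n :: nat} \<and> card T = p}"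
  by (rule finite_subset[of _ "Pow {..<n}"]) auto

lemma koszul_module_carrier:
  "carrier (koszul_module R n p) = {T. T \<subseteq> {..<n} \<and> card T = p} \<rightarrow>\<^sub>E carrier R"
  unfolding koszul_module_def by (rule free_module_finite_carrier[OF koszul_index_finite])

lemma koszul_coeff:
  "u \<in> carrier (koszul_module R n p) \<Longrightarrow> T \<subseteq> {..<n} \<Longrightarrow> card T = p \<Longrightarrow> u T \<in> carrier R"
  by (auto simp: koszul_module_carrier)

lemma koszul_index_insert:
  "T \<subseteq> {..<n} \<Longrightarrow> card T = p \<Longrightarrow> i \<in> {..<n :: nat} - T \<Longrightarrow>
    insert i T \<subseteq> {..<n} \<and> card (insert i T) = Suc p"
  using finite_subset[of T "{..<n}"] by auto

lemma koszul_diff_linear_map: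
  assumes a: "\<And>i. i < n \<Longrightarrow> a i \<in> carrier R"
  shows "linear_map R (koszul_module R n (Suc p)) (koszul_module R n p) (koszul_diff R n a p)"
proof -
  have K: "module R (koszul_module R n q)" for q
    unfolding koszul_module_def by (rule free_module_module)
  have coeff: "u (insert i T) \<in> carrier R"
    if "u \<in> carrier (koszul_module R n (Suc p))" "T \<subseteq> {..<n}" "card T = p" "i \<in> {..<n} - T" for u i T
    using that koszul_index_insert[of T n p i] by (intro koszul_coeff) auto
  define sg where "sg T i = (\<ominus> \<one>) [^] card {t \<in> T. t < i}" for T :: "nat set" and i
  have sg: "sg T i \<in> carrier R" for T i
    by (simp add: sg_def)
  define S where "S = {T. T \<subseteq> {..<n} \<and> card T = p}"
  define D where "D u T = (\<Oplus>i\<in>{..<n} - T. sg T i \<otimes> (a i \<otimes> u (insert i T)))" for u T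
  have diff: "koszul_diff R n a p u T = D u T" if "T \<in> S" for u T
    using that by (simp add: koszul_diff_def S_def D_def sg_def)
  interpret K: module R "koszul_module R n p" by (rule K)
  interpret K': module R "koszul_module R n (Suc p)" by (rule K)
  have closed: "koszul_diff R n a p u \<in> carrier (koszul_module R n p)"
    if u: "u \<in> carrier (koszul_module R n (Suc p))" for u
    unfolding koszul_module_carrier koszul_diff_def
    by (intro restrict_PiE_iff[THEN iffD2] ballI finsum_closed) (use a coeff[OF u] in auto)
  have eqI: "x = y" if "x \<in> carrier (koszul_module R n p)" "y \<in> carrier (koszul_module R n p)"
    "\<And>T. T \<in> S \<Longrightarrow> x T = y T" for x y
    using that unfolding koszul_module_def S_def by (rule free_module_eqI)
  show ?thesis
  proof (intro linear_map.intro linear_map_axioms.intro K closed)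
    fix u assume u: "u \<in> carrier (koszul_module R n (Suc p))"
    show "koszul_diff R n a p (u \<oplus>\<^bsub>koszul_module R n (Suc p)\<^esub> v)
      = koszul_diff R n a p u \<oplus>\<^bsub>koszul_module R n p\<^esub> koszul_diff R n a p v"
      if v: "v \<in> carrier (koszul_module R n (Suc p))" for v
    proof (rule eqI)
      fix T assume T: "T \<in> S"
      then have T': "T \<subseteq> {..<n}" "card T = p" by (auto simp: S_def)
      note c = coeff[OF u T'] coeff[OF v T']
      have "(u \<oplus>\<^bsub>koszul_module R n (Suc p)\<^esub> v) (insert i T) = u (insert i T) \<oplus> v (insert i T)"
        if "i \<in> {..<n} - T" for i
        using koszul_index_insert[OF T' that] by (simp add: koszul_module_def free_module_simps)
      then have "D (u \<oplus>\<^bsub>koszul_module R n (Suc p)\<^esub> v) T = (\<Oplus>i\<in>{..<n} - T.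
          sg T i \<otimes> (a i \<otimes> u (insert i T)) \<oplus> sg T i \<otimes> (a i \<otimes> v (insert i T)))"
        using a c sg unfolding D_def by (intro finsum_cong') (auto simp: r_distr)
      also have "\<dots> = D u T \<oplus> D v T"
        using a c sg unfolding D_def by (intro finsum_addf) auto
      finally show "koszul_diff R n a p (u \<oplus>\<^bsub>koszul_module R n (Suc p)\<^esub> v) T
        = (koszul_diff R n a p u \<oplus>\<^bsub>koszul_module R n p\<^esub> koszul_diff R n a p v) T"
        using T diff by (simp add: koszul_module_def free_module_simps S_def)
    qed (use u v closed in auto)
    show "koszul_diff R n a p (r \<odot>\<^bsub>koszul_module R n (Suc p)\<^esub> u)
      = r \<odot>\<^bsub>koszul_module R n p\<^esub> koszul_diff R n a p u"
      if r: "r \<in> carrier R" for r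
    proof (rule eqI)
      fix T assume T: "T \<in> S"
      then have T': "T \<subseteq> {..<n}" "card T = p" by (auto simp: S_def)
      note c = coeff[OF u T']
      have "(r \<odot>\<^bsub>koszul_module R n (Suc p)\<^esub> u) (insert i T) = r \<otimes> u (insert i T)"
        if "i \<in> {..<n} - T" for i
        using koszul_index_insert[OF T' that] by (simp add: koszul_module_def free_module_simps)
      then have "D (r \<odot>\<^bsub>koszul_module R n (Suc p)\<^esub> u) T
          = (\<Oplus>i\<in>{..<n} - T. r \<otimes> (sg T i \<otimes> (a i \<otimes> u (insert i T))))"
        using a c sg r unfolding D_def by (intro finsum_cong') (auto simp: m_lcomm)
      also have "\<dots> = r \<otimes> D u T"
        using a c sg r unfolding D_def by (intro finsum_rdistr[symmetric]) auto
      finally show "koszul_diff R n a p (r \<odot>\<^bsub>koszul_module R n (Suc p)\<^esub> u) T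
        = (r \<odot>\<^bsub>koszul_module R n p\<^esub> koszul_diff R n a p u) T"
        using T diff by (simp add: koszul_module_def free_module_simps S_def)
    qed (use u r closed in auto)
  qed
qed

lemma koszul_diff_in_ideal:
  assumes I: "ideal I R" and a: "\<And>i. i < n \<Longrightarrow> a i \<in> I"
    and f: "f \<in> carrier (koszul_module R n (Suc p))" and T: "T \<subseteq> {..<n}" "card T = p"
  shows "koszul_diff R n a p f T \<in> I"
proof -
  interpret I: ideal I R by (rule I)
  have "f (insert i T) \<in> carrier R" if "i \<in> {..<n} - T" for i
    using koszul_index_insert[OF T that] by (intro koszul_coeff[OF f]) auto
  then have "(\<lambda>i. (\<ominus> \<one>) [^] card {t \<in> T. t < i} \<otimes> (a i \<otimes> f (insert i T))) \<in> {..<n} - T \<rightarrow> I"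
    using a by (intro Pi_I I.I_l_closed I.I_r_closed) auto
  then show ?thesis
    using T ideal_finsum[OF I] by (simp add: koszul_diff_def)
qed

lemma koszul_diff_0:
  assumes a: "\<And>i. i < n \<Longrightarrow> a i \<in> carrier R"
    and u: "u \<in> carrier (koszul_module R n (Suc 0))"
  shows "koszul_diff R n a 0 u {} = (\<Oplus>i\<in>{..<n}. a i \<otimes> u {i})"
proof -
  have "u {i} \<in> carrier R" if "i < n" for i
    using koszul_coeff[OF u, of "{i}"] that by simp
  then have "(\<Oplus>i\<in>{..<n}. \<one> \<otimes> (a i \<otimes> u {i})) = (\<Oplus>i\<in>{..<n}. a i \<otimes> u {i})"
    using a by (intro finsum_cong') auto
  then show ?thesis
    by (simp add: koszul_diff_def)
qed

lemma koszul_index_1: "{T. T \<subseteq> {..<n} \<and> card T = Suc 0} = (\<lambda>i. {i}) ` {..<n}"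
  by (auto simp: card_1_singleton_iff)

lemma koszul_index_0: "{T. T \<subseteq> {..<n} \<and> card T = 0} = {{}}" for n :: nat
proof -
  have "T = {}" if "T \<subseteq> {..<n}" "card T = 0" for T
    using that finite_subset[OF that(1)] by simp
  then show ?thesis by auto
qed

text \<open>Up to sign, \<open>f\<close> below is the wedge product of \<open>u\<close> and \<open>v\<close>: the coordinate of
  \<open>u \<and> v\<close> at \<open>{i < j}\<close> is the minor \<open>u i v j - u j v i\<close>. Its boundary is given by the
  Leibniz rule \<open>d (u \<and> v) = d u v - d v u\<close>.\<close>

lemma koszul_leibniz:
  fixes n :: nat and a :: "nat \<Rightarrow> 'a"
  defines "K \<equiv> koszul_module R n (Suc 0)" and "d \<equiv> \<lambda>u. koszul_diff R n a 0 u {}"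
  assumes a: "\<And>i. i < n \<Longrightarrow> a i \<in> carrier R"
    and u: "u \<in> carrier K" and v: "v \<in> carrier K"
  shows "d v \<odot>\<^bsub>K\<^esub> u \<ominus>\<^bsub>K\<^esub> d u \<odot>\<^bsub>K\<^esub> v \<in> koszul_boundaries R n a (Suc 0)"
proof -
  define S where "S = {T. T \<subseteq> {..<n} \<and> card T = Suc 0}"
  have K: "K = free_module R S"
    by (simp add: K_def koszul_module_def S_def)
  interpret K: module R K unfolding K by (rule free_module_module)
  have ui: "u {i} \<in> carrier R" and vi: "v {i} \<in> carrier R" if "i < n" for i
    using that u v by (auto simp: K_def intro!: koszul_coeff)
  have d: "d w = (\<Oplus>i\<in>{..<n}. a i \<otimes> w {i})" "d w \<in> carrier R" if "w \<in> carrier K" for w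
  proof -
    show "d w = (\<Oplus>i\<in>{..<n}. a i \<otimes> w {i})"
      using that a by (simp add: d_def K_def koszul_diff_0)
    moreover have "w {i} \<in> carrier R" if "i < n" for i
      using that \<open>w \<in> carrier K\<close> by (auto simp: K_def intro!: koszul_coeff)
    ultimately show "d w \<in> carrier R"
      using a by auto
  qed
  define f where "f = (\<lambda>T\<in>{T. T \<subseteq> {..<n} \<and> card T = Suc (Suc 0)}.
    v {Min T} \<otimes> u {Max T} \<ominus> u {Min T} \<otimes> v {Max T})"
  have f: "f \<in> carrier (koszul_module R n (Suc (Suc 0)))"
    unfolding koszul_module_carrier f_def
  proof (intro restrict_PiE_iff[THEN iffD2] ballI)
    fix T assume T: "T \<in> {T. T \<subseteq> {..<n} \<and> card T = Suc (Suc 0)}"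
    then have "finite T" "T \<noteq> {}"
      using finite_subset[of T "{..<n}"] by auto
    then have "Min T \<in> T" "Max T \<in> T"
      by auto
    then show "v {Min T} \<otimes> u {Max T} \<ominus> u {Min T} \<otimes> v {Max T} \<in> carrier R"
      using T ui vi by (auto simp: subset_iff)
  qed
  interpret D: linear_map R "koszul_module R n (Suc (Suc 0))" K "koszul_diff R n a (Suc 0)"
    unfolding K_def by (rule koszul_diff_linear_map[OF a])
  have "koszul_diff R n a (Suc 0) f = d v \<odot>\<^bsub>K\<^esub> u \<ominus>\<^bsub>K\<^esub> d u \<odot>\<^bsub>K\<^esub> v"
  proof (rule free_module_eqI[of _ S])
    show "koszul_diff R n a (Suc 0) f \<in> carrier (free_module R S)"
      using D.map_closed[OF f] by (simp add: K)
    show "d v \<odot>\<^bsub>K\<^esub> u \<ominus>\<^bsub>K\<^esub> d u \<odot>\<^bsub>K\<^esub> v \<in> carrier (free_module R S)"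
      using u v d(2) by (simp add: K[symmetric])
    fix T assume "T \<in> S"
    then obtain i where i: "T = {i}" "i < n"
      by (auto simp: S_def koszul_index_1)
    note [simp] = ui vi a
    define h where "h j = a j \<otimes> (v {j} \<otimes> u {i} \<ominus> u {j} \<otimes> v {i})" for j
    have h: "h \<in> {..<n} \<rightarrow> carrier R"
      using i by (auto simp: h_def)
    \<comment> \<open>Exchanging the order of \<open>i\<close> and \<open>j\<close> changes the sign both of the minor \<open>f {j, i}\<close> and
      in the differential, so the summand has the same form \<open>h j\<close> in both cases.\<close>
    have summand: "(\<ominus> \<one>) [^] card {t \<in> {i}. t < j} \<otimes> (a j \<otimes> f {j, i}) = h j"
      if j: "j \<in> {..<n} - {i}" for j
    proof (cases "j < i")
      case True
      then have "card {t \<in> {i}. t < j} = 0" by auto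
      moreover have "f {j, i} = v {j} \<otimes> u {i} \<ominus> u {j} \<otimes> v {i}"
        using i True by (simp add: f_def)
      ultimately show ?thesis
        using i True by (simp only: h_def nat_pow_0) simp
    next
      case False
      then have "i < j" using j by auto
      then have "{t \<in> {i}. t < j} = {i}" by auto
      then have "card {t \<in> {i}. t < j} = Suc 0" by simp
      moreover have "f {j, i} = v {i} \<otimes> u {j} \<ominus> u {i} \<otimes> v {j}"
        using i j \<open>i < j\<close> by (simp add: f_def)
      ultimately have "(\<ominus> \<one>) [^] card {t \<in> {i}. t < j} \<otimes> (a j \<otimes> f {j, i})
        = \<ominus> (a j \<otimes> (v {i} \<otimes> u {j} \<ominus> u {i} \<otimes> v {j}))"
        using i j by (simp add: l_minus)
      also have "\<dots> = a j \<otimes> \<ominus> (v {i} \<otimes> u {j} \<ominus> u {i} \<otimes> v {j})"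
        using i j by (simp add: r_minus)
      also have "\<ominus> (v {i} \<otimes> u {j} \<ominus> u {i} \<otimes> v {j}) = v {j} \<otimes> u {i} \<ominus> u {j} \<otimes> v {i}"
        using i j by (simp add: minus_eq minus_add a_comm m_comm)
      finally show ?thesis
        by (simp add: h_def)
    qed
    have "koszul_diff R n a (Suc 0) f T
      = (\<Oplus>j\<in>{..<n} - {i}. (\<ominus> \<one>) [^] card {t \<in> {i}. t < j} \<otimes> (a j \<otimes> f {j, i}))"
      using i by (simp add: koszul_diff_def)
    also have "\<dots> = (\<Oplus>j\<in>{..<n} - {i}. h j)"
      using h summand by (intro finsum_cong') auto
    \<comment> \<open>The missing index may be added, as \<open>h i = \<zero>\<close>.\<close>
    also have "\<dots> = (\<Oplus>j\<in>{..<n}. h j)"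
      using h i by (intro add.finprod_mono_neutral_cong_left)
        (auto simp: h_def m_comm[of "u {i}" "v {i}"] minus_eq r_neg)
    finally have lhs: "koszul_diff R n a (Suc 0) f T = (\<Oplus>j\<in>{..<n}. h j)" .
    have sum_eq: "(\<Oplus>j\<in>{..<n}. h j) \<oplus> d u \<otimes> v {i} = d v \<otimes> u {i}"
    proof -
      have "(\<Oplus>j\<in>{..<n}. h j) \<oplus> d u \<otimes> v {i} = (\<Oplus>j\<in>{..<n}. h j \<oplus> a j \<otimes> u {j} \<otimes> v {i})"
        using h i u by (simp add: d finsum_ldistr finsum_addf Pi_iff)
      also have "\<dots> = (\<Oplus>j\<in>{..<n}. a j \<otimes> v {j} \<otimes> u {i})"
        using i by (intro finsum_cong') (auto simp: h_def minus_eq r_distr r_minus m_assoc a_assoc l_neg)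
      also have "\<dots> = d v \<otimes> u {i}"
        using i v by (simp add: d finsum_ldistr Pi_iff)
      finally show ?thesis .
    qed
    have "(\<Oplus>j\<in>{..<n}. h j) = ((\<Oplus>j\<in>{..<n}. h j) \<oplus> d u \<otimes> v {i}) \<ominus> d u \<otimes> v {i}"
      using i d(2)[OF u] finsum_closed[OF h] by (simp add: minus_eq a_assoc r_neg)
    also have "\<dots> = d v \<otimes> u {i} \<ominus> d u \<otimes> v {i}"
      unfolding sum_eq ..
    also have "\<dots> = (d v \<odot>\<^bsub>K\<^esub> u \<ominus>\<^bsub>K\<^esub> d u \<odot>\<^bsub>K\<^esub> v) T"
      using \<open>T \<in> S\<close> i u v d(2) K.smult_closed[of "d v" u] K.smult_closed[of "d u" v]
      by (simp add: K free_module_a_minus) (simp add: free_module_simps)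
    finally show "koszul_diff R n a (Suc 0) f T = (d v \<odot>\<^bsub>K\<^esub> u \<ominus>\<^bsub>K\<^esub> d u \<odot>\<^bsub>K\<^esub> v) T"
      using lhs by simp
  qed
  then show ?thesis
    using f unfolding koszul_boundaries_def by (metis imageI)
qed

lemma koszul_cycles_1:
  "koszul_cycles R n a (Suc 0)
    = {u \<in> carrier (koszul_module R n (Suc 0)). koszul_diff R n a 0 u {} = \<zero>}"
proof -
  have "koszul_diff R n a 0 u = (\<lambda>T\<in>{T. T \<subseteq> {..<n} \<and> card T = 0}. \<zero>)
    \<longleftrightarrow> koszul_diff R n a 0 u {} = \<zero>" for u
    unfolding koszul_diff_def koszul_index_0 by (auto simp: fun_eq_iff restrict_def)
  then show ?thesis
    by (simp add: koszul_cycles_def a_kernel_def kernel_def koszul_module_def free_module_simps(2))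
qed

text \<open>In degree one the Koszul complex is indexed by singletons and presentations by numbers.
  The next two lemmas translate between these two copies of \<open>R\<^sup>n\<close>.\<close>

lemma vector_of_koszul:
  assumes a: "\<And>i. i < n \<Longrightarrow> a i \<in> carrier R"
    and u: "u \<in> carrier (koszul_module R n (Suc 0))"
  shows "(\<lambda>i\<in>{..<n}. u {i}) \<in> carrier (free_module R {..<n})"
    and "lin_comb R n a (\<lambda>i\<in>{..<n}. u {i}) = koszul_diff R n a 0 u {}"
proof -
  have c: "u {i} \<in> carrier R" if "i < n" for i
    using koszul_coeff[OF u, of "{i}"] that by simp
  then show "(\<lambda>i\<in>{..<n}. u {i}) \<in> carrier (free_module R {..<n})"
    by (simp add: free_module_finite_carrier restrict_PiE_iff)
  show "lin_comb R n a (\<lambda>i\<in>{..<n}. u {i}) = koszul_diff R n a 0 u {}"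
  proof -
    have "koszul_diff R n a 0 u {} = (\<Oplus>i\<in>{..<n}. a i \<otimes> u {i})"
      by (rule koszul_diff_0[OF _ u]) (rule a)
    also have "\<dots> = lin_comb R n a (\<lambda>i\<in>{..<n}. u {i})"
      unfolding lin_comb_def using a c m_comm by (intro finsum_cong') auto
    finally show ?thesis by simp
  qed
qed

lemma koszul_of_vector:
  assumes w: "w \<in> carrier (free_module R {..<n})"
  obtains u where "u \<in> carrier (koszul_module R n (Suc 0))" "(\<lambda>i\<in>{..<n}. u {i}) = w"
proof -
  define u where "u = (\<lambda>T\<in>{T. T \<subseteq> {..<n} \<and> card T = Suc 0}. w (the_elem T))"
  have w_coeff: "w i \<in> carrier R" if "i < n" for i
    using free_module_coeff[OF w] that by simp
  have "w (the_elem T) \<in> carrier R" if "T \<in> {T. T \<subseteq> {..<n} \<and> card T = Suc 0}" for T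
    using that w_coeff unfolding koszul_index_1 by force
  then have "u \<in> carrier (koszul_module R n (Suc 0))"
    unfolding koszul_module_carrier u_def by (simp only: restrict_PiE_iff) blast
  moreover have "(\<lambda>i\<in>{..<n}. u {i}) = w"
  proof (rule PiE_ext)
    show "w \<in> {..<n} \<rightarrow>\<^sub>E carrier R"
      using w by (simp add: free_module_finite_carrier)
    show "(\<lambda>i\<in>{..<n}. u {i}) \<in> {..<n} \<rightarrow>\<^sub>E carrier R"
      using w_coeff by (simp add: restrict_PiE_iff u_def)
  qed (simp add: u_def)
  ultimately show ?thesis
    using that by blast
qed

end

section \<open>The annihilator of the first Koszul homology module\<close>

theorem proposition2p6:
  fixes R :: "('a, 'r) ring_scheme" and I :: "'a set"
    and n m :: nat and a :: "nat \<Rightarrow> 'a" and \<phi> :: "nat \<Rightarrow> nat \<Rightarrow> 'a"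
  assumes "cring R" and "noetherian_ring R" and "ideal I R"
    and "minimal_presentation R I n m a \<phi>"
  shows "annihilator R (koszul_homology R n a 1) \<subseteq> ideal_colon R I (entry_ideal R n m \<phi>) \<and>
    (syzygetic R I \<longrightarrow>
      annihilator R (koszul_homology R n a 1) = ideal_colon R I (entry_ideal R n m \<phi>))"
proof -
  interpret R: cring R by (rule assms(1))
  interpret I: ideal I R by (rule assms(3))
  have a: "\<And>i. i < n \<Longrightarrow> a i \<in> carrier R"
    and \<phi>: "\<And>i j. i < n \<Longrightarrow> j < m \<Longrightarrow> \<phi> i j \<in> carrier R"
    and image: "lin_comb R n a ` carrier (free_module R {..<n}) = I"
    and syz: "matrix_map R n m \<phi> ` carrier (free_module R {..<m}) = syzygies R I n a"
    using assms(4) by (auto simp: minimal_presentation_def presentation_def)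
  define K where "K = koszul_module R n (Suc 0)"
  define d where "d u = koszul_diff R n a 0 u {}" for u
  define Z where "Z = koszul_cycles R n a (Suc 0)"
  define B where "B = koszul_boundaries R n a (Suc 0)"
  have K: "K = free_module R {T. T \<subseteq> {..<n} \<and> card T = Suc 0}"
    by (simp add: K_def koszul_module_def)
  interpret K: module R K
    unfolding K by (rule R.free_module_module)
  interpret D: linear_map R K "koszul_module R n 0" "koszul_diff R n a 0"
    unfolding K_def by (rule R.koszul_diff_linear_map[OF a])
  interpret D2: linear_map R "koszul_module R n (Suc (Suc 0))" K "koszul_diff R n a (Suc 0)"
    unfolding K_def by (rule R.koszul_diff_linear_map[OF a])
  have d: "linear_map R K R.regular_module d"
  proof (intro linear_map.intro linear_map_axioms.intro K.module_axioms R.regular_module_module)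
    interpret c: linear_map R "koszul_module R n 0" R.regular_module "\<lambda>f. f {}"
      unfolding koszul_module_def by (rule R.coeff_linear_map) simp
    show "d x \<in> carrier R.regular_module" if "x \<in> carrier K" for x
      using that c.map_closed D.map_closed by (simp add: d_def)
    show "d (x \<oplus>\<^bsub>K\<^esub> y) = d x \<oplus>\<^bsub>R.regular_module\<^esub> d y" if "x \<in> carrier K" "y \<in> carrier K" for x y
      using that c.map_add D.map_closed by (simp add: d_def D.map_add)
    show "d (r \<odot>\<^bsub>K\<^esub> x) = r \<odot>\<^bsub>R.regular_module\<^esub> d x" if "r \<in> carrier R" "x \<in> carrier K" for r x
      using that c.map_smult D.map_closed by (simp add: d_def D.map_smult)
  qed
  interpret d: linear_map R K R.regular_module d by (rule d)
  note vec = R.vector_of_koszul[of n a, OF a, folded K_def d_def, simplified]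
  have Z: "Z = {u \<in> carrier K. d u = \<zero>\<^bsub>R\<^esub>}"
    by (simp add: Z_def K_def d_def R.koszul_cycles_1)
  have subZ: "submodule Z R K"
    using d.preimage_submodule[OF d.N.submodule_zero] by (simp add: Z R.ideal_module_simps)
  have subB: "submodule B R K"
    unfolding B_def koszul_boundaries_def by (rule D2.image_submodule)
  have ann: "annihilator R (koszul_homology R n a 1) = {r \<in> carrier R. \<forall>z\<in>Z. r \<odot>\<^bsub>K\<^esub> z \<in> B}"
    using K.annihilator_quotient_module[OF subB subZ]
    by (simp add: koszul_homology_def K_def Z_def B_def)
  have colon: "ideal_colon R I (entry_ideal R n m \<phi>)
    = {r \<in> carrier R. \<forall>i<n. \<forall>j<m. r \<otimes>\<^bsub>R\<^esub> \<phi> i j \<in> I}"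
    unfolding entry_ideal_def using \<phi>
    by (subst R.ideal_colon_genideal[OF assms(3)]) blast+
  have coeff: "(r \<odot>\<^bsub>K\<^esub> u) {i} = r \<otimes>\<^bsub>R\<^esub> u {i}" if "i < n" for r u i
    using that by (simp add: K R.free_module_simps)
  have syzygies: "syzygies R I n a
    = {w \<in> carrier (free_module R {..<n}). lin_comb R n a w = \<zero>\<^bsub>R\<^esub>}"
    by (simp add: syzygies_def a_kernel_def kernel_def R.ideal_module_simps)
  have d_image: "d ` carrier K = I"
  proof
    show "d ` carrier K \<subseteq> I"
      using vec image by (metis image_subsetI imageI)
    show "I \<subseteq> d ` carrier K"
    proof
      fix x assume "x \<in> I"
      then obtain w where w: "w \<in> carrier (free_module R {..<n})" "lin_comb R n a w = x"
        using image by blast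
      obtain u where "u \<in> carrier K" "(\<lambda>i\<in>{..<n}. u {i}) = w"
        using R.koszul_of_vector[OF w(1)] unfolding K_def .
      then show "x \<in> d ` carrier K"
        using vec w(2) by blast
    qed
  qed
  have aI: "a i \<in> I" if i: "i < n" for i
  proof -
    have e: "basis_vec R {..<n} i \<in> carrier (free_module R {..<n})"
      using i by (simp add: R.basis_vec_closed)
    have "lin_comb R n a (basis_vec R {..<n} i) = (\<Oplus>\<^bsub>R\<^esub>k\<in>{..<n}. a k \<otimes>\<^bsub>R\<^esub> basis_vec R {..<n} i k)"
      unfolding lin_comb_def
      by (rule R.finsum_cong') (use a R.free_module_coeff[OF e] R.m_comm in auto)
    also have "\<dots> = a i"
      using i a by (intro R.finsum_basis_vec) auto
    finally show ?thesis
      using image imageI[OF e, of "lin_comb R n a"] by simp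
  qed
  \<comment> \<open>Each column of \<open>\<phi>\<close> is a cycle, and boundaries have their coordinates in \<open>I\<close>.\<close>
  have first: "r \<otimes>\<^bsub>R\<^esub> \<phi> i j \<in> I"
    if r: "r \<in> carrier R" "\<forall>z\<in>Z. r \<odot>\<^bsub>K\<^esub> z \<in> B" and ij: "i < n" "j < m" for r i j
  proof -
    define w where "w = matrix_map R n m \<phi> (basis_vec R {..<m} j)"
    have "w \<in> syzygies R I n a"
      using ij syz R.basis_vec_closed[of j "{..<m}"] unfolding w_def by blast
    then have w: "w \<in> carrier (free_module R {..<n})" "lin_comb R n a w = \<zero>\<^bsub>R\<^esub>"
      by (simp_all add: syzygies)
    have wi: "w i = \<phi> i j"
      using ij \<phi> R.finsum_basis_vec[of "{..<m}" j "\<phi> i"] by (simp add: w_def matrix_map_def)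
    obtain u where u: "u \<in> carrier K" "(\<lambda>i\<in>{..<n}. u {i}) = w"
      using R.koszul_of_vector[OF w(1)] unfolding K_def .
    have "u \<in> Z"
      using u w(2) vec(2)[OF u(1)] by (simp add: Z)
    then obtain f where f: "f \<in> carrier (koszul_module R n (Suc (Suc 0)))"
      "r \<odot>\<^bsub>K\<^esub> u = koszul_diff R n a (Suc 0) f"
      using r by (auto simp: B_def koszul_boundaries_def)
    have "koszul_diff R n a (Suc 0) f {i} \<in> I"
      by (rule R.koszul_diff_in_ideal[OF assms(3) aI f(1)]) (use ij in auto)
    moreover have "u {i} = \<phi> i j"
      using u(2) wi ij by (metis lessThan_iff restrict_apply')
    ultimately show ?thesis
      using f(2) coeff[OF ij(1), of r u] by simp
  qed
  \<comment> \<open>Every cycle is a combination of columns of \<open>\<phi>\<close>, so \<open>r\<close> moves its coordinates into \<open>I\<close>.\<close>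
  have second: "r \<odot>\<^bsub>K\<^esub> z \<in> B"
    if syzygetic: "syzygetic R I" and r: "r \<in> carrier R" "\<forall>i<n. \<forall>j<m. r \<otimes>\<^bsub>R\<^esub> \<phi> i j \<in> I"
      and z: "z \<in> Z" for r z
  proof -
    have zK: "z \<in> carrier K" and dz: "d z = \<zero>\<^bsub>R\<^esub>"
      using z by (auto simp: Z)
    have "(\<lambda>i\<in>{..<n}. z {i}) \<in> syzygies R I n a"
      using vec[OF zK] dz by (simp add: syzygies)
    then obtain x where x: "x \<in> carrier (free_module R {..<m})"
      "(\<lambda>i\<in>{..<n}. z {i}) = matrix_map R n m \<phi> x"
      using syz by blast
    have xj: "x j \<in> carrier R" if "j < m" for j
      using R.free_module_coeff[OF x(1)] that by simp
    have entry: "(r \<odot>\<^bsub>K\<^esub> z) {i} \<in> I" if i: "i < n" for i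
    proof -
      have "z {i} = (\<Oplus>\<^bsub>R\<^esub>j\<in>{..<m}. \<phi> i j \<otimes>\<^bsub>R\<^esub> x j)"
        using fun_cong[OF x(2), of i] i by (simp add: matrix_map_def)
      then have "r \<otimes>\<^bsub>R\<^esub> z {i} = (\<Oplus>\<^bsub>R\<^esub>j\<in>{..<m}. r \<otimes>\<^bsub>R\<^esub> (\<phi> i j \<otimes>\<^bsub>R\<^esub> x j))"
        using r(1) \<phi> i xj by (simp add: R.finsum_rdistr Pi_iff)
      moreover have "r \<otimes>\<^bsub>R\<^esub> (\<phi> i j \<otimes>\<^bsub>R\<^esub> x j) \<in> I" if "j < m" for j
        using that r \<phi> i xj I.I_r_closed[of "r \<otimes>\<^bsub>R\<^esub> \<phi> i j" "x j"] by (simp add: R.m_assoc)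
      ultimately show ?thesis
        using R.ideal_finsum[OF assms(3), of _ "{..<m}"] i by (simp add: coeff)
    qed
    show ?thesis
    proof (rule R.syzygetic_cycle_in_submodule[OF assms(3) syzygetic R.koszul_index_finite _ _ _ _ _ _,
          of n "Suc 0", folded K])
      show "linear_map R K R.regular_module d" by (rule d)
      show "d ` carrier K = I" by (rule d_image)
      show "submodule B R K" by (rule subB)
      show "d v \<odot>\<^bsub>K\<^esub> u \<ominus>\<^bsub>K\<^esub> d u \<odot>\<^bsub>K\<^esub> v \<in> B" if "u \<in> carrier K" "v \<in> carrier K" for u v
        using R.koszul_leibniz[of n a u v, OF a] that by (simp add: K_def d_def B_def)
      show "r \<odot>\<^bsub>K\<^esub> z \<in> carrier K" using r(1) zK by simp
      show "d (r \<odot>\<^bsub>K\<^esub> z) = \<zero>\<^bsub>R\<^esub>"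
        using r(1) zK dz by (simp add: d.map_smult R.ideal_module_simps)
      show "(r \<odot>\<^bsub>K\<^esub> z) T \<in> I" if "T \<in> {T. T \<subseteq> {..<n} \<and> card T = Suc 0}" for T
        using that entry unfolding R.koszul_index_1 by auto
    qed
  qed
  show ?thesis
    unfolding ann colon using first second by blast
qed

end
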